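(* Let $G$ be a group and let $S$ be a domain. If the group ring $SG$ is right Noetherian or left Noetherian, then $G$ is amenable and every subgroup of $G$ is finitely generated.
   Context: Rings are associative with identity and are not assumed commutative; a domain is a nonzero (not necessarily commutative) ring without zero divisors other than $0$. Groups are discrete. $SG$ denotes the group ring of $G$ with coefficients in $S$. *)

theory Defs
  imports Complex_Main "HOL-Library.Poly_Mapping"
begin

text \<open>
  Arbitrary (not necessarily commutative) groups are the types of class \<^class>\<open>group_add\<close>, so
  the group operation is written additively although it need not commute.  Domains are the types
  of class \<^class>\<open>ring_1_no_zero_divisors\<close>, which includes \<open>0 \<noteq> 1\<close> but not commutativity.

  The multiplication of \<^typ>\<open>'g \<Rightarrow>\<^sub>0 's\<close> is convolution along the addition of \<open>'g\<close>: by
  \<open>mult_single\<close>, the product of \<open>a\<close> at \<open>g\<close> and \<open>b\<close> at \<open>h\<close> is \<open>a * b\<close> at \<open>g + h\<close>.  With \<open>'g\<close> a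
  group, this is the usual group ring, in which coefficients commute with group elements but not
  necessarily with each other.
\<close>

type_synonym ('s, 'g) group_ring = "'g \<Rightarrow>\<^sub>0 's"

definition right_ideal :: "'r::ring_1 set \<Rightarrow> bool" where
  "right_ideal I \<longleftrightarrow> 0 \<in> I \<and> (\<forall>x\<in>I. \<forall>y\<in>I. x + y \<in> I) \<and> (\<forall>x\<in>I. \<forall>r. x * r \<in> I)"

definition left_ideal :: "'r::ring_1 set \<Rightarrow> bool" where
  "left_ideal I \<longleftrightarrow> 0 \<in> I \<and> (\<forall>x\<in>I. \<forall>y\<in>I. x + y \<in> I) \<and> (\<forall>x\<in>I. \<forall>r. r * x \<in> I)"

definition right_noetherian :: "'r::ring_1 itself \<Rightarrow> bool" where
  "right_noetherian _ \<longleftrightarrow>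
     (\<forall>I::'r set. right_ideal I \<longrightarrow> (\<exists>A. finite A \<and> I = right_ideal hull A))"

definition left_noetherian :: "'r::ring_1 itself \<Rightarrow> bool" where
  "left_noetherian _ \<longleftrightarrow>
     (\<forall>I::'r set. left_ideal I \<longrightarrow> (\<exists>A. finite A \<and> I = left_ideal hull A))"

definition add_subgroup :: "'g::group_add set \<Rightarrow> bool" where
  "add_subgroup H \<longleftrightarrow> 0 \<in> H \<and> (\<forall>x\<in>H. \<forall>y\<in>H. x + y \<in> H) \<and> (\<forall>x\<in>H. - x \<in> H)"

definition fin_gen_subgroup :: "'g::group_add set \<Rightarrow> bool" where
  "fin_gen_subgroup H \<longleftrightarrow> add_subgroup H \<and> (\<exists>A. finite A \<and> H = add_subgroup hull A)"

text \<open>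
  Amenability of a discrete group: there is a finitely additive, left-invariant probability
  measure defined on all of its subsets.
\<close>

definition amenable :: "'g::group_add itself \<Rightarrow> bool" where
  "amenable _ \<longleftrightarrow>
     (\<exists>\<mu> :: 'g set \<Rightarrow> real.
        (\<forall>A. 0 \<le> \<mu> A) \<and>
        \<mu> UNIV = 1 \<and>
        (\<forall>A B. A \<inter> B = {} \<longrightarrow> \<mu> (A \<union> B) = \<mu> A + \<mu> B) \<and>
        (\<forall>g A. \<mu> ((\<lambda>x. g + x) ` A) = \<mu> A))"

lemma right_ideal_hull: "right_ideal (right_ideal hull A)"
  by (rule hull_in) (auto simp: right_ideal_def)

lemma left_ideal_hull: "left_ideal (left_ideal hull A)"
  by (rule hull_in) (auto simp: left_ideal_def)

lemma add_subgroup_hull: "add_subgroup (add_subgroup hull A)"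
  by (rule hull_in) (auto simp: add_subgroup_def)

end

theory Submission
  imports Defs "HOL-Analysis.Function_Topology" "HOL-Library.Set_Algebras"
begin

text \<open>
  A failure of amenability is turned into an injective linear map from a free right module over
  the group ring into a free module of smaller finite rank, and a Noetherian ring admits no such
  map.  The map is a variant of a construction of Bartholdi; Kropholler and Lorensen used that
  construction for group rings over domains.

  \<^emph>\<open>Noetherian side.\<close>  If \<open>A\<close> is an injective \<open>n \<times> m\<close> matrix over \<open>R\<close> with \<open>n < m\<close>, then the first \<open>n\<close>
  columns of \<open>A\<close> form an injective endomorphism of \<open>R\<^sup>n\<close> whose image is independent of the next
  column.  Applying the powers of this endomorphism to that column yields infinitely many
  independent vectors in \<open>R\<^sup>n\<close>, which \<open>right_noetherian_sequence_dependent\<close> excludes.  So \<open>R\<close>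
  satisfies the strong rank condition, and counting coefficients transfers the condition to the
  polynomial ring \<open>R[x]\<close> (\<open>strong_rank_condition_polynomials\<close>).  The variable \<open>x\<close> supplies
  infinitely many central elements of the coefficient ring, whatever its characteristic.

  \<^emph>\<open>Group side.\<close>  If \<open>G\<close> is not amenable, the Foelner condition fails (\<open>folner_imp_amenable\<close>), so
  a finite set expands all finite sets by a fixed factor.  The \<open>k\<close>-fold sum \<open>T\<close> of this set expands them by a
  factor exponential in \<open>k\<close>, while \<open>log (card T)\<close> is only linear in \<open>k\<close>.  Choose subsets
  \<open>X t\<close> (\<open>t \<in> T\<close>) of a finite set \<open>Y\<close> such that for every nonempty \<open>I \<subseteq> T\<close> a proportion of order
  \<open>1 / log (card T)\<close> of the points of \<open>Y\<close> lies in exactly one \<open>X t\<close> with \<open>t \<in> I\<close>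
  (\<open>isolating_family\<close>).  Double counting (\<open>expansion_isolates\<close>) gives in every finite nonempty \<open>F\<close>
  an element \<open>f\<close> with more than \<open>card Y\<close> isolated pairs \<open>(t, y)\<close>: at position \<open>t + f\<close> and
  coordinate \<open>y\<close>, only the value at \<open>f\<close> of a vector supported on \<open>F\<close> contributes.

  \<^emph>\<open>The map.\<close>  Let \<open>R = SG\<close>.  The matrix over \<open>R[x]\<close> with \<open>card Y\<close> rows, \<open>card Y + 1\<close> columns and
  entries the sums of \<open>x ^ (c (t, y) * i) t\<close> over the \<open>t\<close> with \<open>y \<in> X t\<close>, where \<open>c\<close> is injective,
  then has trivial kernel.  Indeed, at an isolated pair of \<open>f\<close> it evaluates the polynomial in a
  further variable whose coefficients are the values at \<open>f\<close> at the point \<open>x ^ c (t, y)\<close>.  More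
  than \<open>card Y\<close> zeros at distinct central points force a polynomial of degree at most \<open>card Y\<close> to
  vanish (\<open>central_vandermonde\<close>); as \<open>f\<close> was in the support, this is absurd.

  Finite generation of a subgroup \<open>H\<close> comes from the right ideal generated by the \<open>h - 1\<close>: finitely
  many of them already generate it, and summing coefficients over the subgroup generated by these
  finitely many \<open>h\<close> shows that this subgroup is all of \<open>H\<close>.  The left Noetherian case reduces
  to the right one over the opposite coefficient domain.
\<close>

section \<open>Convolution with monomials\<close>

lemma poly_mapping_monomial_induct [case_names zero single add]:
  assumes "P 0" "\<And>k a. P (Poly_Mapping.single k a)" "\<And>p q. P p \<Longrightarrow> P q \<Longrightarrow> P (p + q)"
  shows "P (p :: 'k \<Rightarrow>\<^sub>0 'a::comm_monoid_add)"
proof (induction p rule: Poly_Mapping.update_induct)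
  case const
  then show ?case by (rule assms(1))
next
  case (update f k a)
  have "Poly_Mapping.update k a f = Poly_Mapping.single k a + f"
    using update.hyps by (intro poly_mapping_eqI)
      (auto simp: lookup_update lookup_add lookup_single not_in_keys_iff_lookup_eq_zero when_def)
  then show ?case using assms(2,3) update by metis
qed

lemma lookup_single_mult:
  fixes r :: "'k::monoid_add \<Rightarrow>\<^sub>0 'a::semiring_0"
  assumes "\<And>q q'. k + q = k + q' \<Longrightarrow> q = q'"
  shows "Poly_Mapping.lookup (Poly_Mapping.single k a * r) (k + p) = a * Poly_Mapping.lookup r p"
proof (induction r rule: poly_mapping_monomial_induct)
  case (single k' b)
  then show ?case using assms by (auto simp: mult_single lookup_single when_def)
qed (auto simp: distrib_left lookup_add)

lemma lookup_mult_single: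
  fixes r :: "'k::monoid_add \<Rightarrow>\<^sub>0 'a::semiring_0"
  assumes "\<And>q q'. q + k = q' + k \<Longrightarrow> q = q'"
  shows "Poly_Mapping.lookup (r * Poly_Mapping.single k a) (p + k) = Poly_Mapping.lookup r p * a"
proof (induction r rule: poly_mapping_monomial_induct)
  case (single k' b)
  then show ?case using assms by (auto simp: mult_single lookup_single when_def)
qed (auto simp: distrib_right lookup_add)

lemma lookup_single_mult_nat:
  fixes r :: "nat \<Rightarrow>\<^sub>0 'a::semiring_0"
  shows "Poly_Mapping.lookup (Poly_Mapping.single k a * r) n = (if k \<le> n then a * Poly_Mapping.lookup r (n - k) else 0)"
proof (cases "k \<le> n")
  case True
  then show ?thesis using lookup_single_mult[of k a r "n - k"] by simp
next
  case False
  then show ?thesis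
  proof (induction r rule: poly_mapping_monomial_induct)
    case (single k' b)
    then show ?case by (auto simp: mult_single lookup_single when_def)
  qed (auto simp: distrib_left lookup_add)
qed

lemma lookup_mult_single_nat:
  fixes r :: "nat \<Rightarrow>\<^sub>0 'a::semiring_0"
  shows "Poly_Mapping.lookup (r * Poly_Mapping.single k a) n = (if k \<le> n then Poly_Mapping.lookup r (n - k) * a else 0)"
proof (cases "k \<le> n")
  case True
  then show ?thesis using lookup_mult_single[of k r a "n - k"] by simp
next
  case False
  then show ?thesis
  proof (induction r rule: poly_mapping_monomial_induct)
    case (single k' b)
    then show ?case by (auto simp: mult_single lookup_single when_def)
  qed (auto simp: distrib_right lookup_add)
qed

lemma lookup_single_mult_group:
  fixes r :: "'g::group_add \<Rightarrow>\<^sub>0 'a::semiring_0"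
  shows "Poly_Mapping.lookup (Poly_Mapping.single k a * r) p = a * Poly_Mapping.lookup r (- k + p)"
  using lookup_single_mult[of k a r "- k + p"] by (simp add: add.assoc[symmetric])

lemma central_monomial:
  fixes r :: "nat \<Rightarrow>\<^sub>0 'a::ring_1"
  shows "Poly_Mapping.single n 1 * r = r * Poly_Mapping.single n 1"
  by (rule poly_mapping_eqI) (simp add: lookup_single_mult_nat lookup_mult_single_nat)

lemma monomial_power:
  "Poly_Mapping.single n (1::'a::ring_1) ^ i = Poly_Mapping.single (n * i :: nat) 1"
  by (induction i) (auto simp: mult_single)

lemma lookup_map:
  assumes "f 0 = 0"
  shows "Poly_Mapping.lookup (Poly_Mapping.map f p) k = f (Poly_Mapping.lookup p k)"
  using assms by (simp add: Poly_Mapping.map.rep_eq when_def)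

section \<open>Noetherian rings and the strong rank condition\<close>

lemma right_idealI:
  assumes "0 \<in> I" "\<And>x y. x \<in> I \<Longrightarrow> y \<in> I \<Longrightarrow> x + y \<in> I" "\<And>x r. x \<in> I \<Longrightarrow> x * r \<in> I"
  shows "right_ideal I"
  using assms by (simp add: right_ideal_def)

lemma
  shows zero_in_right_ideal_hull: "0 \<in> right_ideal hull X"
    and right_ideal_hull_add:
      "x \<in> right_ideal hull X \<Longrightarrow> y \<in> right_ideal hull X \<Longrightarrow> x + y \<in> right_ideal hull X"
    and right_ideal_hull_mult: "x \<in> right_ideal hull X \<Longrightarrow> x * r \<in> right_ideal hull X"
  using right_ideal_hull[of X] by (simp_all add: right_ideal_def)

lemma right_ideal_hull_finite_support:
  fixes x :: "'a::ring_1"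
  assumes "x \<in> right_ideal hull X"
  shows "\<exists>F. finite F \<and> F \<subseteq> X \<and> x \<in> right_ideal hull F"
proof -
  let ?U = "{x. \<exists>F. finite F \<and> F \<subseteq> X \<and> x \<in> right_ideal hull F}"
  have mono: "right_ideal hull F \<subseteq> right_ideal hull (F \<union> F')" for F F' :: "'a set"
    by (simp add: hull_mono)
  have "right_ideal ?U"
  proof (rule right_idealI)
    show "0 \<in> ?U" using zero_in_right_ideal_hull[of "{}"] by (intro CollectI exI[of _ "{}"]) simp
  next
    fix x y assume "x \<in> ?U" "y \<in> ?U"
    then obtain F F' where *: "finite F" "F \<subseteq> X" "x \<in> right_ideal hull F"
      "finite F'" "F' \<subseteq> X" "y \<in> right_ideal hull F'" by blast
    then have "x \<in> right_ideal hull (F \<union> F')" "y \<in> right_ideal hull (F \<union> F')"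
      using mono[of F F'] mono[of F' F] by (auto simp: Un_commute)
    then have "x + y \<in> right_ideal hull (F \<union> F')" by (rule right_ideal_hull_add)
    then show "x + y \<in> ?U" using * by (intro CollectI exI[of _ "F \<union> F'"]) simp
  next
    fix x r assume "x \<in> ?U"
    then show "x * r \<in> ?U" by (auto intro: right_ideal_hull_mult)
  qed
  moreover have "X \<subseteq> ?U"
  proof
    fix x assume "x \<in> X"
    then show "x \<in> ?U" by (intro CollectI exI[of _ "{x}"]) (simp add: hull_inc)
  qed
  ultimately show ?thesis using hull_minimal[of X ?U right_ideal] assms by blast
qed

lemma right_noetherian_finite_generation:
  assumes "right_noetherian TYPE('r::ring_1)"
  shows "\<exists>F. finite F \<and> F \<subseteq> X \<and> X \<subseteq> right_ideal hull (F :: 'r set)"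
proof -
  obtain A where A: "finite A" "right_ideal hull X = right_ideal hull A"
    using assms right_ideal_hull[of X] unfolding right_noetherian_def by blast
  have "\<forall>a\<in>A. \<exists>F. finite F \<and> F \<subseteq> X \<and> a \<in> right_ideal hull F"
    using right_ideal_hull_finite_support A hull_subset[of A right_ideal] by blast
  then obtain F where F: "\<And>a. a \<in> A \<Longrightarrow> finite (F a) \<and> F a \<subseteq> X \<and> a \<in> right_ideal hull (F a)"
    by metis
  have "A \<subseteq> right_ideal hull (\<Union>(F ` A))"
    using F hull_mono[of "F _" "\<Union>(F ` A)" right_ideal] by blast
  then have "right_ideal hull X \<subseteq> right_ideal hull (\<Union>(F ` A))"
    unfolding A by (intro hull_minimal right_ideal_hull)
  then show ?thesis
    using F A(1) hull_subset[of X right_ideal] by (intro exI[of _ "\<Union>(F ` A)"]) blast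
qed

lemma right_ideal_hull_image_combination:
  assumes "finite J" "x \<in> right_ideal hull (u ` J)"
  shows "\<exists>c. x = (\<Sum>j\<in>J. u j * c j)"
proof -
  let ?C = "{x. \<exists>c. x = (\<Sum>j\<in>J. u j * c j)}"
  have "right_ideal ?C"
  proof (rule right_idealI)
    show "0 \<in> ?C" by (auto intro!: exI[of _ "\<lambda>_. 0"])
  next
    fix x y assume "x \<in> ?C" "y \<in> ?C"
    then obtain c d where "x = (\<Sum>j\<in>J. u j * c j)" "y = (\<Sum>j\<in>J. u j * d j)" by blast
    then have "x + y = (\<Sum>j\<in>J. u j * (c j + d j))" by (simp add: distrib_left sum.distrib)
    then show "x + y \<in> ?C" by (intro CollectI exI)
  next
    fix x r assume "x \<in> ?C"
    then obtain c where "x = (\<Sum>j\<in>J. u j * c j)" by blast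
    then have "x * r = (\<Sum>j\<in>J. u j * (c j * r))" by (simp add: sum_distrib_right mult.assoc)
    then show "x * r \<in> ?C" by (intro CollectI exI)
  qed
  moreover have "u j \<in> ?C" if "j \<in> J" for j
    using that assms(1)
    by (auto intro!: exI[of _ "\<lambda>i. if i = j then 1 else 0"] simp: if_distrib cong: if_cong)
  ultimately have "right_ideal hull (u ` J) \<subseteq> ?C" by (intro hull_minimal) auto
  then show ?thesis using assms(2) by blast
qed

text \<open>
  Induction on the number of coordinates: the entries in one coordinate generate a finitely
  generated right ideal, so from some index on they can be cleared by subtracting combinations of
  the first few vectors, which leaves a sequence with one coordinate fewer.  A relation between
  the cleared vectors unfolds to one between the original vectors, and it stays nontrivial since
  the coefficients at large indices are unchanged.
\<close>

lemma right_noetherian_sequence_dependent: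
  fixes v :: "nat \<Rightarrow> 'i \<Rightarrow> 'r::ring_1"
  assumes R: "right_noetherian TYPE('r)" and "finite E"
  shows "\<exists>m r. (\<exists>k<m. r k \<noteq> 0) \<and> (\<forall>i\<in>E. (\<Sum>k<m. v k i * r k) = 0)"
  using \<open>finite E\<close>
proof (induction E arbitrary: v rule: finite_induct)
  case empty
  show ?case by (intro exI[of _ 1] exI[of _ "\<lambda>_. 1"]) auto
next
  case (insert i E)
  obtain F where F: "finite F" "F \<subseteq> range (\<lambda>k. v k i)" "range (\<lambda>k. v k i) \<subseteq> right_ideal hull F"
    using right_noetherian_finite_generation[OF R] by metis
  obtain J where J: "finite J" "F = (\<lambda>k. v k i) ` J"
    using finite_subset_image[OF F(1,2)] by blast
  obtain K where "\<forall>j\<in>J. j < K"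
    using J(1) finite_nat_set_iff_bounded by blast
  then have K: "J \<subseteq> {..<K}" by auto
  have "v k i \<in> right_ideal hull ((\<lambda>k. v k i) ` {..<K})" for k
    using F(3) hull_mono[of F "(\<lambda>k. v k i) ` {..<K}" right_ideal] J(2) K by blast
  then have "\<exists>c. v k i = (\<Sum>j<K. v j i * c j)" for k
    by (intro right_ideal_hull_image_combination) auto
  then obtain c where c: "\<And>k. v k i = (\<Sum>j<K. v j i * c k j)" by metis
  define w where "w k i' = v (K + k) i' - (\<Sum>j<K. v j i' * c (K + k) j)" for k i'
  obtain m r where r: "\<exists>k<m. r k \<noteq> 0" "\<forall>i\<in>E. (\<Sum>k<m. w k i * r k) = 0"
    using insert.IH by metis
  have wi: "w k i = 0" for k unfolding w_def using c[of "K + k"] by simp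
  define r' where
    "r' k = (if k < K then - (\<Sum>l<m. c (K + l) k * r l) else r (k - K))" for k
  have split: "(\<Sum>k<K + m. f k) = (\<Sum>k<K. f k) + (\<Sum>k<m. f (K + k))" for f :: "nat \<Rightarrow> 'r"
    by (induction m) (auto simp: add.assoc)
  have "(\<Sum>k<K + m. v k i' * r' k) = (\<Sum>k<m. w k i' * r k)" for i'
  proof -
    have "(\<Sum>k<K + m. v k i' * r' k) =
        - (\<Sum>j<K. \<Sum>l<m. v j i' * c (K + l) j * r l) + (\<Sum>k<m. v (K + k) i' * r k)"
      unfolding split r'_def by (simp add: sum_distrib_left sum_negf mult.assoc)
    also have "(\<Sum>j<K. \<Sum>l<m. v j i' * c (K + l) j * r l) =
        (\<Sum>l<m. (\<Sum>j<K. v j i' * c (K + l) j) * r l)"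
      by (subst sum.swap) (simp add: sum_distrib_right)
    finally show ?thesis unfolding w_def by (simp add: left_diff_distrib sum_subtractf)
  qed
  then have "\<forall>i'\<in>insert i E. (\<Sum>k<K + m. v k i' * r' k) = 0" using r(2) wi by simp
  moreover have "\<exists>k<K + m. r' k \<noteq> 0"
  proof -
    obtain k where "k < m" "r k \<noteq> 0" using r(1) by blast
    then show ?thesis by (intro exI[of _ "K + k"]) (simp add: r'_def)
  qed
  ultimately show ?case by blast
qed

text \<open>
  Matrices act from the left and scalars from the right, so this says that no free right module of
  finite rank embeds into one of smaller rank.
\<close>

definition strong_rank_condition :: "'r::ring_1 itself \<Rightarrow> bool" where
  "strong_rank_condition _ \<longleftrightarrow>
     (\<forall>n m (A :: nat \<Rightarrow> nat \<Rightarrow> 'r). n < m \<longrightarrow>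
        (\<exists>r. (\<exists>j<m. r j \<noteq> 0) \<and> (\<forall>i<n. (\<Sum>j<m. A i j * r j) = 0)))"

lemma strong_rank_condition_finite_sets:
  assumes "strong_rank_condition TYPE('r::ring_1)"
    and "finite D" "finite E" "card E < card D"
  shows "\<exists>r. (\<exists>d\<in>D. r d \<noteq> 0) \<and> (\<forall>e\<in>E. (\<Sum>d\<in>D. A e d * r d) = (0 :: 'r))"
proof -
  obtain f where f: "bij_betw f {..<card D} D"
    using ex_bij_betw_nat_finite[OF assms(2)] by (auto simp: atLeast0LessThan)
  obtain h where h: "bij_betw h {..<card E} E"
    using ex_bij_betw_nat_finite[OF assms(3)] by (auto simp: atLeast0LessThan)
  obtain r where r: "\<exists>j<card D. r j \<noteq> 0"
    "\<forall>i<card E. (\<Sum>j<card D. A (h i) (f j) * r j) = 0"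
    using assms(1,4) unfolding strong_rank_condition_def
    by (elim allE[where x="card E"] allE[where x="card D"]
        allE[where x="\<lambda>i j. A (h i) (f j)"]) auto
  define g where "g = inv_into {..<card D} f"
  have g: "g (f j) = j" if "j < card D" for j
    unfolding g_def using f that by (simp add: bij_betw_def inv_into_f_f)
  show ?thesis
  proof (intro exI[of _ "\<lambda>d. r (g d)"] conjI ballI)
    obtain j where "j < card D" "r j \<noteq> 0" using r(1) by blast
    then show "\<exists>d\<in>D. r (g d) \<noteq> 0"
      using g f by (intro bexI[of _ "f j"]) (auto simp: bij_betw_def)
  next
    fix e assume "e \<in> E"
    then obtain i where i: "i < card E" "e = h i" using h by (auto simp: bij_betw_def)
    have "(\<Sum>d\<in>D. A e d * r (g d)) = (\<Sum>j<card D. A e (f j) * r (g (f j)))"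
      by (rule sum.reindex_bij_betw[OF f, symmetric])
    then show "(\<Sum>d\<in>D. A e d * r (g d)) = 0" using r(2) i g by simp
  qed
qed

text \<open>
  If the matrix had trivial kernel, its first \<open>n\<close> columns would define an injective endomorphism
  \<open>\<alpha>\<close> of \<open>R\<^sup>n\<close> with image independent of the column \<open>a\<close> number \<open>n\<close>.  The vectors
  \<open>a, \<alpha> a, \<alpha>\<^sup>2 a, \<dots>\<close> are then independent: a relation has the form \<open>a r + \<alpha> z = 0\<close>, so \<open>r = 0\<close> and
  \<open>z = 0\<close>, where \<open>z = 0\<close> is a shorter relation.
\<close>

lemma right_noetherian_imp_strong_rank_condition:
  assumes R: "right_noetherian TYPE('r::ring_1)"
  shows "strong_rank_condition TYPE('r)"
  unfolding strong_rank_condition_def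
proof (intro allI impI, rule ccontr)
  fix n m :: nat and A :: "nat \<Rightarrow> nat \<Rightarrow> 'r"
  assume "n < m"
  assume "\<nexists>r. (\<exists>j<m. r j \<noteq> 0) \<and> (\<forall>i<n. (\<Sum>j<m. A i j * r j) = 0)"
  then have inj: "r j = 0" if "\<forall>i<n. (\<Sum>j<m. A i j * r j) = 0" "j < m" for r j
    using that by blast
  define v where "v = rec_nat (\<lambda>i. A i n) (\<lambda>_ u i. \<Sum>j<n. A i j * u j)"
  have v0: "v 0 = (\<lambda>i. A i n)" and vSuc: "v (Suc k) = (\<lambda>i. \<Sum>j<n. A i j * v k j)" for k
    by (simp_all add: v_def)
  have indep: "\<forall>k<l. r k = 0" if "\<forall>i<n. (\<Sum>k<l. v k i * r k) = 0" for l r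
    using that
  proof (induction l arbitrary: r)
    case (Suc l)
    \<comment> \<open>The relation, regrouped as a kernel vector of \<open>A\<close>.\<close>
    define z where "z j = (if j < n then \<Sum>k<l. v k j * r (Suc k) else if j = n then r 0 else 0)" for j
    have "\<forall>i<n. (\<Sum>j<m. A i j * z j) = 0"
    proof (intro allI impI)
      fix i assume i: "i < n"
      have "(\<Sum>j<m. A i j * z j) = (\<Sum>j<Suc n. A i j * z j)"
        using \<open>n < m\<close> by (intro sum.mono_neutral_right) (auto simp: z_def)
      also have "\<dots> = (\<Sum>j<n. \<Sum>k<l. A i j * v k j * r (Suc k)) + v 0 i * r 0"
        by (simp add: z_def v0 sum_distrib_left mult.assoc)
      also have "(\<Sum>j<n. \<Sum>k<l. A i j * v k j * r (Suc k)) = (\<Sum>k<l. v (Suc k) i * r (Suc k))"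
        by (subst sum.swap) (simp add: vSuc sum_distrib_right)
      also have "\<dots> + v 0 i * r 0 = (\<Sum>k<Suc l. v k i * r k)"
        by (simp only: sum.lessThan_Suc_shift add.commute)
      finally show "(\<Sum>j<m. A i j * z j) = 0" using Suc.prems i by simp
    qed
    then have z: "z j = 0" if "j < m" for j using inj that by blast
    have "r 0 = 0" using z[of n] \<open>n < m\<close> by (simp add: z_def)
    moreover have "\<forall>i<n. (\<Sum>k<l. v k i * r (Suc k)) = 0"
      using z \<open>n < m\<close> unfolding z_def by (metis less_trans)
    then have "\<forall>k<l. r (Suc k) = 0" by (rule Suc.IH)
    ultimately show ?case by (metis less_Suc_eq_0_disj)
  qed simp
  obtain l r where "\<exists>k<l. r k \<noteq> 0" "\<forall>i\<in>{..<n}. (\<Sum>k<l. v k i * r k) = 0"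
    using right_noetherian_sequence_dependent[OF R, of "{..<n}" v] by blast
  then show False using indep[of r l] by (metis lessThan_iff)
qed

text \<open>
  Vectors of polynomials of degree below \<open>k\<close> have \<open>m k\<close> coefficients, and a matrix with entries of
  degree below \<open>c\<close> sends them to vectors with at most \<open>n (k + c)\<close> coefficients.  As \<open>n < m\<close>, the
  first number exceeds the second for large \<open>k\<close>.
\<close>

lemma strong_rank_condition_polynomials:
  assumes "strong_rank_condition TYPE('r::ring_1)"
  shows "strong_rank_condition TYPE(nat \<Rightarrow>\<^sub>0 'r)"
  unfolding strong_rank_condition_def
proof (intro allI impI)
  fix n m :: nat and A :: "nat \<Rightarrow> nat \<Rightarrow> nat \<Rightarrow>\<^sub>0 'r"
  assume "n < m"
  define Z where "Z = (\<Union>i\<in>{..<n}. \<Union>j\<in>{..<m}. Poly_Mapping.keys (A i j))"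
  have "finite Z" by (simp add: Z_def)
  then obtain c where Z: "\<forall>e\<in>Z. e < c"
    using finite_nat_set_iff_bounded by blast
  have c: "Poly_Mapping.lookup (A i j) e = 0" if "i < n" "j < m" "c \<le> e" for i j e
  proof (rule ccontr)
    assume "Poly_Mapping.lookup (A i j) e \<noteq> 0"
    then have "e \<in> Z" using that(1,2) unfolding Z_def by (auto simp: in_keys_iff)
    then show False using Z that(3) by fastforce
  qed
  \<comment> \<open>Any \<open>k > n * c\<close> satisfies \<open>n * (k + c) < Suc n * k\<close>.\<close>
  define k where "k = n * c + 1"
  have "n * (k + c) < Suc n * k" by (simp add: k_def algebra_simps)
  also have "\<dots> \<le> m * k" using \<open>n < m\<close> by (intro mult_right_mono) auto
  finally have card: "card ({..<n} \<times> {..<k + c}) < card ({..<m} \<times> {..<k})"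
    by (simp add: card_cartesian_product)
  define B where "B = (\<lambda>(i, e) (j, l). if l \<le> e then Poly_Mapping.lookup (A i j) (e - l) else 0)"
  obtain \<rho> where \<rho>: "\<exists>d\<in>{..<m} \<times> {..<k}. \<rho> d \<noteq> 0"
    "\<forall>e\<in>{..<n} \<times> {..<k + c}. (\<Sum>d\<in>{..<m} \<times> {..<k}. B e d * \<rho> d) = 0"
    using strong_rank_condition_finite_sets[OF assms _ _ card, of B] by auto
  define r where "r j = (\<Sum>l<k. Poly_Mapping.single l (\<rho> (j, l)))" for j
  have r_lookup: "Poly_Mapping.lookup (r j) l = \<rho> (j, l)" if "l < k" for j l
    using that by (simp add: r_def lookup_sum lookup_single when_def)
  show "\<exists>r. (\<exists>j<m. r j \<noteq> 0) \<and> (\<forall>i<n. (\<Sum>j<m. A i j * r j) = 0)"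
  proof (intro exI[of _ r] conjI allI impI)
    obtain j l where "j < m" "l < k" "\<rho> (j, l) \<noteq> 0" using \<rho>(1) by auto
    then show "\<exists>j<m. r j \<noteq> 0" using r_lookup by (metis lookup_zero)
  next
    fix i assume i: "i < n"
    show "(\<Sum>j<m. A i j * r j) = 0"
    proof (rule poly_mapping_eqI)
      fix e
      have "Poly_Mapping.lookup (\<Sum>j<m. A i j * r j) e = (\<Sum>j<m. \<Sum>l<k. B (i, e) (j, l) * \<rho> (j, l))"
        unfolding lookup_sum r_def sum_distrib_left B_def
        by (intro sum.cong) (auto simp: lookup_mult_single_nat)
      also have "\<dots> = (\<Sum>d\<in>{..<m} \<times> {..<k}. B (i, e) d * \<rho> d)"
        by (simp add: sum.cartesian_product case_prod_unfold)
      also have "\<dots> = 0"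
      proof (cases "e < k + c")
        case True
        then show ?thesis using \<rho>(2) i by auto
      next
        case False
        then show ?thesis using c i by (intro sum.neutral) (auto simp: B_def)
      qed
      finally show "Poly_Mapping.lookup (\<Sum>j<m. A i j * r j) e = Poly_Mapping.lookup 0 e" by simp
    qed
  qed
qed

section \<open>Isolation in expanding groups\<close>

text \<open>
  A multiscale random construction, written as a count.  A point of \<open>Y\<close> consists of a level \<open>l\<close> and a
  function \<open>h\<close>, and \<open>X t\<close> asks for an event of probability \<open>2\<^sup>-\<^sup>l\<close> that depends on \<open>h t\<close> only.  If \<open>2\<^sup>l\<close>
  is between two and four times \<open>card I\<close>, then at level \<open>l\<close> exactly one of these events with
  \<open>t \<in> I\<close> occurs with probability at least 1/8: each of the \<open>card I\<close> choices of that \<open>t\<close> contributes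
  at least half of its own probability, by Bernoulli's inequality.  As there are \<open>L + 2\<close> levels,
  the proportion in all of \<open>Y\<close> is at least \<open>1 / (8 (L + 2))\<close>.
\<close>

lemma isolating_family:
  fixes T :: "'t set"
  assumes "finite T" "card T \<le> 2 ^ L"
  shows "\<exists>(Y :: (nat \<times> ('t \<Rightarrow> nat)) set) X. finite Y \<and> Y \<noteq> {} \<and> (\<forall>t. X t \<subseteq> Y) \<and>
    (\<forall>I. I \<subseteq> T \<longrightarrow> I \<noteq> {} \<longrightarrow> card Y \<le> 8 * (L + 2) * card {y \<in> Y. \<exists>!t. t \<in> I \<and> y \<in> X t})"
proof -
  define M :: nat where "M = 2 ^ (L + 1)"
  define Y where "Y = {..L + 1} \<times> (T \<rightarrow>\<^sub>E {..<M})"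
  define X where "X t = {(l, h) \<in> Y. h t < 2 ^ (L + 1 - l)}" for t
  have "M > 0" by (simp add: M_def)
  have "finite Y" using assms(1) by (simp add: Y_def finite_PiE)
  have card_Y: "card Y = (L + 2) * M ^ card T"
    using assms(1) by (simp add: Y_def card_cartesian_product card_PiE)
  then have "Y \<noteq> {}" using \<open>M > 0\<close> by (metis card.empty mult_is_0 not_gr0 add_is_0 power_not_zero zero_neq_numeral)
  have "card Y \<le> 8 * (L + 2) * card {y \<in> Y. \<exists>!t. t \<in> I \<and> y \<in> X t}" (is "_ \<le> _ * card ?U")
    if I: "I \<subseteq> T" "I \<noteq> {}" for I
  proof -
    define k where "k = card I"
    have "finite I" using I assms(1) finite_subset by blast
    then have "k \<ge> 1" using I unfolding k_def by (simp add: Suc_leI card_gt_0_iff)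
    have "k \<le> card T" using I assms(1) by (simp add: k_def card_mono)
    obtain n where n: "2 ^ n < 2 * k" "2 * k \<le> 2 ^ (n + 1)"
      using ex_power_ivl2[of 2 "2 * k"] \<open>k \<ge> 1\<close> by auto
    define l where "l = n + 1"
    have l: "2 * k \<le> 2 ^ l" "2 ^ l < 4 * k" using n by (auto simp: l_def)
    have "(2::nat) ^ n < 2 ^ (L + 1)" using n(1) \<open>k \<le> card T\<close> assms(2) by simp
    then have "l \<le> L + 1" unfolding l_def using power_less_imp_less_exp[of "2::nat" n "L + 1"] by simp
    define a :: nat where "a = 2 ^ (L + 1 - l)"
    have M: "M = 2 ^ l * a" unfolding M_def a_def using \<open>l \<le> L + 1\<close> by (simp add: power_add[symmetric])
    have "a > 0" by (simp add: a_def)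
    have ka: "2 * (k * a) \<le> M" "M \<le> 4 * (k * a)"
      using l \<open>a > 0\<close> unfolding M by (auto simp: mult.assoc[symmetric] intro!: mult_right_mono)
    have "a \<le> M" using \<open>a > 0\<close> by (simp add: M)
    \<comment> \<open>\<open>W s\<close>: the points of level \<open>l\<close> at which \<open>s\<close> is the only element of \<open>I\<close> whose event occurs.\<close>
    define B where "B s t = (if t = s then {..<a} else if t \<in> I then {a..<M} else {..<M})" for s t
    define W where "W s = {l} \<times> (Pi\<^sub>E T (B s))" for s
    have W_Y: "W s \<subseteq> Y" for s
      using \<open>a \<le> M\<close> \<open>l \<le> L + 1\<close> unfolding W_def Y_def
      by (intro Sigma_mono PiE_mono) (auto simp: B_def)
    have W_X: "y \<in> X t \<longleftrightarrow> t = s" if "y \<in> W s" "s \<in> I" "t \<in> I" for s t y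
    proof -
      obtain h where h: "y = (l, h)" "h \<in> Pi\<^sub>E T (B s)" using \<open>y \<in> W s\<close> by (auto simp: W_def)
      have "h t \<in> B s t" using h(2) I(1) \<open>t \<in> I\<close> by blast
      moreover have "y \<in> X t \<longleftrightarrow> h t < a"
        using W_Y[of s] \<open>y \<in> W s\<close> by (auto simp: X_def a_def h(1))
      ultimately show ?thesis using \<open>t \<in> I\<close> by (cases "t = s") (simp_all add: B_def)
    qed
    have "(\<Union>s\<in>I. W s) \<subseteq> ?U" using W_X W_Y by blast
    then have "card (\<Union>s\<in>I. W s) \<le> card ?U" using \<open>finite Y\<close> by (intro card_mono) auto
    moreover have "card (\<Union>s\<in>I. W s) = (\<Sum>s\<in>I. card (W s))"
    proof (rule card_UN_disjoint)
      show "\<forall>s\<in>I. finite (W s)" using W_Y \<open>finite Y\<close> finite_subset by blast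
      show "\<forall>s\<in>I. \<forall>t\<in>I. s \<noteq> t \<longrightarrow> W s \<inter> W t = {}" using W_X by blast
    qed (fact \<open>finite I\<close>)
    moreover have "card (W s) = a * (M - a) ^ (k - 1) * M ^ (card T - k)" if "s \<in> I" for s
    proof -
      have "card (W s) = (\<Prod>t\<in>T. card (B s t))"
        using assms(1) by (simp add: W_def card_cartesian_product card_PiE)
      also have "\<dots> = (\<Prod>t\<in>I. card (B s t)) * (\<Prod>t\<in>T - I. card (B s t))"
        using I(1) assms(1) by (simp add: prod.subset_diff mult.commute)
      also have "(\<Prod>t\<in>I. card (B s t)) = card (B s s) * (\<Prod>t\<in>I - {s}. card (B s t))"
        using that \<open>finite I\<close> by (rule prod.remove[rotated])
      also have "(\<Prod>t\<in>I - {s}. card (B s t)) = (\<Prod>t\<in>I - {s}. M - a)"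
        by (intro prod.cong) (auto simp: B_def)
      also have "\<dots> = (M - a) ^ (k - 1)"
        using that \<open>finite I\<close> by (simp add: k_def)
      also have "(\<Prod>t\<in>T - I. card (B s t)) = (\<Prod>t\<in>T - I. M)"
        using that by (intro prod.cong) (auto simp: B_def)
      also have "\<dots> = M ^ (card T - k)"
        using I(1) \<open>finite I\<close> by (simp add: k_def card_Diff_subset)
      finally show ?thesis by (simp add: B_def)
    qed
    ultimately have card_U: "k * (a * (M - a) ^ (k - 1) * M ^ (card T - k)) \<le> card ?U"
      by (simp add: k_def)
    have "M ^ (k - 1) \<le> 2 * (M - a) ^ (k - 1)"
    proof -
      define j where "j = k - 1"
      have "2 * (j * a) \<le> 2 * (k * a)" unfolding j_def by (intro mult_left_mono mult_right_mono) auto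
      then have "2 * (j * a) \<le> M" using ka(1) by (rule le_trans)
      then have "2 * (real j * real a) \<le> real M" by (simp flip: of_nat_mult)
      then have *: "real j * (real a / M) \<le> 1 / 2" using \<open>M > 0\<close> by (simp add: field_simps)
      have "real a / M \<le> 1" using \<open>a \<le> M\<close> \<open>M > 0\<close> by simp
      then have "1 + real j * (- (real a / M)) \<le> (1 + - (real a / M)) ^ j"
        by (intro Bernoulli_inequality) simp
      then have "1 \<le> 2 * (1 + - (real a / M)) ^ j" using * by simp
      also have "1 + - (real a / M) = real (M - a) / M"
        using \<open>a \<le> M\<close> \<open>M > 0\<close> by (simp add: field_simps of_nat_diff)
      finally have "1 \<le> 2 * real (M - a) ^ j / real M ^ j" by (simp add: power_divide)
      then have "real M ^ j \<le> 2 * real (M - a) ^ j"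
        using \<open>M > 0\<close> by (simp add: le_divide_eq)
      then have "real (M ^ j) \<le> real (2 * (M - a) ^ j)" by simp
      then show ?thesis unfolding j_def of_nat_le_iff .
    qed
    have "M ^ card T = M * M ^ (k - 1) * M ^ (card T - k)"
      using \<open>k \<ge> 1\<close> \<open>k \<le> card T\<close> by (simp flip: power_Suc power_add)
    then have "M ^ card T \<le> M * M ^ (k - 1) * M ^ (card T - k)" by (rule eq_refl)
    also have "M * M ^ (k - 1) * M ^ (card T - k)
        \<le> (4 * (k * a)) * (2 * (M - a) ^ (k - 1)) * M ^ (card T - k)"
      using ka(2) \<open>M ^ (k - 1) \<le> 2 * (M - a) ^ (k - 1)\<close> by (intro mult_mono) auto
    finally have "M ^ card T \<le> 8 * (k * (a * (M - a) ^ (k - 1) * M ^ (card T - k)))"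
      by (simp only: ac_simps)
    then have "M ^ card T \<le> 8 * card ?U" using mult_le_mono2[OF card_U, of 8] by (rule le_trans)
    then have "(L + 2) * M ^ card T \<le> (L + 2) * (8 * card ?U)" by (rule mult_le_mono2)
    then show ?thesis unfolding card_Y by (simp only: ac_simps)
  qed
  then show ?thesis
    using \<open>finite Y\<close> \<open>Y \<noteq> {}\<close> by (intro exI[of _ Y] exI[of _ X]) (auto simp: X_def)
qed

text \<open>
  A vector supported on \<open>F\<close> is spread by sending its value at \<open>f\<close> to the coordinates \<open>y \<in> X t\<close> at
  position \<open>t + f\<close>, for each \<open>t \<in> T\<close>.  The isolated pairs of \<open>f\<close> are those at which no other element
  of \<open>F\<close> interferes.
\<close>

definition isolated_pairs ::
    "'g::group_add set \<Rightarrow> ('g \<Rightarrow> 'y set) \<Rightarrow> 'g set \<Rightarrow> 'g \<Rightarrow> ('g \<times> 'y) set" where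
  "isolated_pairs T X F f = {(t, y). t \<in> T \<and> y \<in> X t \<and>
     (\<forall>t'\<in>T. y \<in> X t' \<and> - t' + (t + f) \<in> F \<longrightarrow> t' = t)}"

text \<open>
  Double counting: at each of the many positions \<open>p\<close> in \<open>T + F\<close>, the set of \<open>t\<close> with \<open>- t + p \<in> F\<close> is
  nonempty and so has at least \<open>card Y / N\<close> isolated coordinates.  Each isolated coordinate
  belongs to an isolated pair of one element of \<open>F\<close>, and these are too many for all elements of
  \<open>F\<close> to have at most \<open>card Y\<close>.
\<close>

lemma expansion_isolates:
  fixes T :: "'g::group_add set" and X :: "'g \<Rightarrow> 'y set"
  assumes "finite T" "finite Y" "Y \<noteq> {}" "\<And>t. X t \<subseteq> Y" "finite F"
    and isol: "\<And>I. I \<subseteq> T \<Longrightarrow> I \<noteq> {} \<Longrightarrow> card Y \<le> N * card {y \<in> Y. \<exists>!t. t \<in> I \<and> y \<in> X t}"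
    and exp: "N * card F < card (T + F)"
  shows "\<exists>f\<in>F. card Y < card (isolated_pairs T X F f)"
proof (rule ccontr)
  let ?W = "\<lambda>f. {(t, y). t \<in> T \<and> y \<in> X t \<and>
    (\<forall>t'\<in>T. y \<in> X t' \<and> - t' + (t + f) \<in> F \<longrightarrow> t' = t)}"
  assume "\<not> (\<exists>f\<in>F. card Y < card (isolated_pairs T X F f))"
  then have small: "card (?W f) \<le> card Y" if "f \<in> F" for f
    using that unfolding isolated_pairs_def by (meson not_le)
  define I where "I p = {t \<in> T. - t + p \<in> F}" for p
  define U where "U p = {y \<in> Y. \<exists>!t. t \<in> I p \<and> y \<in> X t}" for p
  have finTF: "finite (T + F)" using assms by (intro finite_set_plus)
  have finW: "finite (?W f)" for f
    by (rule finite_subset[of _ "T \<times> Y"]) (use assms in auto)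
  have "card Y * card (T + F) = (\<Sum>p\<in>T + F. card Y)" by simp
  also have "\<dots> \<le> (\<Sum>p\<in>T + F. N * card (U p))"
  proof (rule sum_mono)
    fix p assume "p \<in> T + F"
    then obtain t f where "t \<in> T" "f \<in> F" "p = t + f" by (auto elim: set_plus_elim)
    then have "t \<in> I p" by (simp add: I_def add.assoc[symmetric])
    moreover have "I p \<subseteq> T" by (auto simp: I_def)
    ultimately show "card Y \<le> N * card (U p)" unfolding U_def by (intro isol) auto
  qed
  also have "\<dots> = N * card (SIGMA p:T + F. U p)"
    using finTF assms(2) by (simp add: sum_distrib_left[symmetric] U_def)
  also have "card (SIGMA p:T + F. U p) \<le> card ((\<lambda>(f, t, y). (t + f, y)) ` (SIGMA f:F. ?W f))"
  proof (rule card_mono)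
    show "finite ((\<lambda>(f, t, y). (t + f, y)) ` (SIGMA f:F. ?W f))"
      using finW assms(5) by (intro finite_imageI finite_SigmaI)
    show "(SIGMA p:T + F. U p) \<subseteq> (\<lambda>(f, t, y). (t + f, y)) ` (SIGMA f:F. ?W f)"
    proof (clarify)
      fix p y assume "y \<in> U p"
      then obtain t where t: "t \<in> I p" "y \<in> X t" "\<And>t'. t' \<in> I p \<Longrightarrow> y \<in> X t' \<Longrightarrow> t' = t"
        unfolding U_def by auto
      have p: "t + (- t + p) = p" by (simp add: add.assoc[symmetric])
      have "\<forall>t'\<in>T. y \<in> X t' \<and> - t' + (t + (- t + p)) \<in> F \<longrightarrow> t' = t"
        unfolding p using t(3) unfolding I_def by blast
      moreover have "t \<in> T" "- t + p \<in> F" using t(1) by (auto simp: I_def)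
      ultimately have "(- t + p, t, y) \<in> (SIGMA f:F. ?W f)" using t(2) by blast
      then have "(\<lambda>(f, t, y). (t + f, y)) (- t + p, t, y) \<in> (\<lambda>(f, t, y). (t + f, y)) ` (SIGMA f:F. ?W f)"
        by (rule imageI)
      then show "(p, y) \<in> (\<lambda>(f, t, y). (t + f, y)) ` (SIGMA f:F. ?W f)" by (simp add: p)
    qed
  qed
  also have "\<dots> \<le> card (SIGMA f:F. ?W f)" using finW assms(5) by (intro card_image_le finite_SigmaI)
  also have "\<dots> = (\<Sum>f\<in>F. card (?W f))" using finW assms(5) by (intro card_SigmaI) auto
  also have "\<dots> \<le> (\<Sum>f\<in>F. card Y)" using small by (rule sum_mono)
  finally have "card Y * card (T + F) \<le> card Y * (N * card F)" by (simp add: ac_simps)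
  then show False using exp assms(2,3) by (simp add: card_gt_0_iff)
qed

lemma iterated_expansion:
  fixes T :: "'g::group_add set" and \<epsilon> :: real
  assumes "finite T" "\<epsilon> > 0"
    and exp: "\<And>F. finite F \<Longrightarrow> F \<noteq> {} \<Longrightarrow> (1 + \<epsilon>) * card F \<le> real (card (T + F))"
  shows "\<exists>T' :: 'g set. finite T' \<and> card T' \<le> card T ^ k \<and>
    (\<forall>F. finite F \<longrightarrow> F \<noteq> {} \<longrightarrow> (1 + \<epsilon>) ^ k * card F \<le> real (card (T' + F)))"
proof (induction k)
  case 0
  have zero: "{0} + F = F" for F :: "'g set" by (auto simp: set_plus_def)
  show ?case by (rule exI[of _ "{0::'g}"]) (simp add: zero)
next
  case (Suc k)
  then obtain T' :: "'g set" where "finite T' \<and> card T' \<le> card T ^ k \<and>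
    (\<forall>F. finite F \<longrightarrow> F \<noteq> {} \<longrightarrow> (1 + \<epsilon>) ^ k * card F \<le> real (card (T' + F)))" ..
  then have T': "finite T'" "card T' \<le> card T ^ k"
    "\<And>F. finite F \<Longrightarrow> F \<noteq> {} \<Longrightarrow> (1 + \<epsilon>) ^ k * card F \<le> real (card (T' + F))" by auto
  have "T \<noteq> {}" using exp[of "{0}"] \<open>\<epsilon> > 0\<close> by auto
  show ?case
  proof (intro exI[of _ "T' + T"] conjI allI impI)
    show "finite (T' + T)" using T' assms by (intro finite_set_plus)
    have "card (T' + T) \<le> card (T' \<times> T)"
      unfolding set_plus_image using T' assms by (intro card_image_le) auto
    then show "card (T' + T) \<le> card T ^ Suc k"
      using T'(2) by (simp add: card_cartesian_product) (metis mult.commute mult_le_mono2 le_trans)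
  next
    fix F :: "'g set" assume F: "finite F" "F \<noteq> {}"
    have "(1 + \<epsilon>) ^ Suc k * card F = (1 + \<epsilon>) ^ k * ((1 + \<epsilon>) * card F)" by simp
    also have "\<dots> \<le> (1 + \<epsilon>) ^ k * card (T + F)" using exp[OF F] \<open>\<epsilon> > 0\<close> by (intro mult_left_mono) auto
    also have "\<dots> \<le> card (T' + (T + F))"
      using F \<open>T \<noteq> {}\<close> assms by (intro T'(3) finite_set_plus) (auto simp: set_plus_def)
    finally show "(1 + \<epsilon>) ^ Suc k * card F \<le> card (T' + T + F)" by (simp add: add.assoc)
  qed
qed

lemma exponential_beats_linear:
  fixes x b c :: real
  assumes "x > 1"
  shows "\<exists>k::nat. b * k + c < x ^ k"
proof -
  have "(\<lambda>k. real k * (1 / x) ^ k) \<longlonglongrightarrow> 0" and "(\<lambda>k. (1 / x) ^ k) \<longlonglongrightarrow> 0"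
    using assms by (auto intro!: powser_times_n_limit_0 LIMSEQ_realpow_zero)
  from tendsto_add[OF tendsto_mult_left[OF this(1), of b] tendsto_mult_left[OF this(2), of c]]
  have "(\<lambda>k. b * (real k * (1 / x) ^ k) + c * (1 / x) ^ k) \<longlonglongrightarrow> b * 0 + c * 0" .
  
  then have "\<forall>\<^sub>F k in sequentially. b * (real k * (1 / x) ^ k) + c * (1 / x) ^ k < 1"
    by (intro order_tendstoD) auto
  then obtain k where "b * (real k * (1 / x) ^ k) + c * (1 / x) ^ k < 1"
    using eventually_happens'[OF sequentially_bot] by blast
  then have "b * k + c < x ^ k" using assms by (simp add: power_divide field_simps)
  then show ?thesis ..
qed

section \<open>A wide matrix with trivial kernel\<close>

text \<open>
  A nonzero polynomial of degree below \<open>d\<close> over a domain has fewer than \<open>d\<close> central zeros.  Only the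
  points have to be central; the coefficients \<open>v i\<close> need not commute with each other.
\<close>

lemma central_vandermonde:
  fixes v :: "nat \<Rightarrow> 'r::ring_1_no_zero_divisors"
  assumes "finite C" and "\<And>t r. t \<in> C \<Longrightarrow> t * r = r * t" and "d \<le> card C"
    and "\<And>t. t \<in> C \<Longrightarrow> (\<Sum>i<d. t ^ i * v i) = 0"
  shows "\<forall>i<d. v i = 0"
  using assms
proof (induction d arbitrary: C v)
  case (Suc d)
  note central = Suc.prems(2) and root = Suc.prems(4)
  obtain t where t: "t \<in> C" using Suc.prems(3) by fastforce
  \<comment> \<open>The coefficients of the quotient on division by the linear factor of \<open>t\<close>.\<close>
  define q where "q j = (\<Sum>i\<in>{j..<d}. t ^ (i - j) * v (Suc i))" for j
  have q_rec: "v (Suc j) = q j - t * q (Suc j)" if "j < d" for j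
  proof -
    have "q j = v (Suc j) + (\<Sum>i\<in>{Suc j..<d}. t ^ (i - j) * v (Suc i))"
      unfolding q_def using that by (simp add: sum.atLeast_Suc_lessThan)
    also have "(\<Sum>i\<in>{Suc j..<d}. t ^ (i - j) * v (Suc i)) = t * q (Suc j)"
      unfolding q_def sum_distrib_left
      by (intro sum.cong) (auto simp: mult.assoc[symmetric] power_Suc[symmetric] Suc_diff_Suc)
    finally show ?thesis by simp
  qed
  have q_d: "q d = 0" by (simp add: q_def)
  have division: "(\<Sum>i<Suc d. s ^ i * v i) = v 0 + t * q 0 + (s - t) * (\<Sum>j<d. s ^ j * q j)" for s
  proof -
    have "v 0 + (\<Sum>i<e. s ^ Suc i * v (Suc i)) =
        v 0 + t * q 0 + (s - t) * (\<Sum>j<e. s ^ j * q j) - t * (s ^ e * q e)" if "e \<le> d" for e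
      using that
    proof (induction e)
      case (Suc e)
      have comm: "s ^ Suc e * (t * z) = t * (s ^ Suc e * z)" for z
        using central[OF t, of "s ^ Suc e"] by (simp only: mult.assoc[symmetric])
      have "s ^ Suc e * v (Suc e) = s * (s ^ e * q e) - t * (s ^ Suc e * q (Suc e))"
        using q_rec[of e] Suc.prems comm by (simp add: right_diff_distrib mult.assoc)
      then show ?case using Suc by (simp add: distrib_left left_diff_distrib)
    qed simp
    from this[of d] show ?thesis
      by (simp add: q_d sum.lessThan_Suc_shift del: sum.lessThan_Suc)
  qed
  have rem: "v 0 + t * q 0 = 0" using division[of t] root[OF t] by simp
  have "\<forall>j<d. q j = 0"
  proof (rule Suc.IH[of "C - {t}"])
    show "d \<le> card (C - {t})" using Suc.prems(1,3) t by simp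
  next
    fix s assume s: "s \<in> C - {t}"
    then have "(s - t) * (\<Sum>j<d. s ^ j * q j) = 0"
      using division[of s] root[of s] rem by simp
    then show "(\<Sum>j<d. s ^ j * q j) = 0" using s by simp
  qed (use Suc.prems(1) central in auto)
  then have "v (Suc j) = 0" if "j < d" for j
    using q_rec[OF that] q_d that by (cases "Suc j = d") auto
  moreover have "v 0 = 0" using rem q_d \<open>\<forall>j<d. q j = 0\<close> by (cases d) auto
  ultimately show ?case by (metis less_Suc_eq_0_disj)
qed simp

lemma not_strong_rank_condition:
  fixes T :: "'g::group_add set" and X :: "'g \<Rightarrow> 'y set"
  assumes "finite T" "finite Y" and XY: "\<And>t. X t \<subseteq> Y"
    and isolated: "\<And>F. finite F \<Longrightarrow> F \<noteq> {} \<Longrightarrow> 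
      \<exists>f\<in>F. card Y < card (isolated_pairs T X F f)"
  shows "\<not> strong_rank_condition TYPE(nat \<Rightarrow>\<^sub>0 ('s::ring_1_no_zero_divisors, 'g) group_ring)"
proof
  assume src: "strong_rank_condition TYPE(nat \<Rightarrow>\<^sub>0 ('s, 'g) group_ring)"
  obtain c :: "'g \<times> 'y \<Rightarrow> nat" where c: "inj_on c (T \<times> Y)"
    using finite_imp_inj_to_nat_seg[of "T \<times> Y"] assms(1,2) by blast
  define A :: "'y \<Rightarrow> nat \<Rightarrow> nat \<Rightarrow>\<^sub>0 ('s, 'g) group_ring" where
    "A y i = (\<Sum>t | t \<in> T \<and> y \<in> X t. Poly_Mapping.single (c (t, y) * i) (Poly_Mapping.single t 1))" for y i
  obtain \<phi> where \<phi>: "\<exists>i\<in>{..card Y}. \<phi> i \<noteq> 0" "\<forall>y\<in>Y. (\<Sum>i\<in>{..card Y}. A y i * \<phi> i) = 0"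
    using strong_rank_condition_finite_sets[OF src, of "{..card Y}" Y A] assms(2) by auto
  \<comment> \<open>\<open>coeff g (\<phi> i)\<close> is the value of the vector \<open>\<phi>\<close> at \<open>g\<close> in column \<open>i\<close>, a polynomial over \<open>'s\<close>;
    \<open>F\<close> is the support of \<open>\<phi>\<close>.\<close>
  define coeff :: "'g \<Rightarrow> (nat \<Rightarrow>\<^sub>0 ('s, 'g) group_ring) \<Rightarrow> nat \<Rightarrow>\<^sub>0 's" where
    "coeff g = Poly_Mapping.map (\<lambda>r. Poly_Mapping.lookup r g)" for g
  have lookup_coeff: "Poly_Mapping.lookup (coeff g p) n = Poly_Mapping.lookup (Poly_Mapping.lookup p n) g" for g p n
    unfolding coeff_def by (rule lookup_map) simp
  have coeff_sum: "coeff g (sum f B) = (\<Sum>b\<in>B. coeff g (f b))" for g and f :: "'b \<Rightarrow> _" and B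
    by (rule poly_mapping_eqI) (simp add: lookup_coeff lookup_sum)
  have coeff_zero: "coeff g 0 = 0" for g
    by (rule poly_mapping_eqI) (simp add: lookup_coeff)
  have coeff_mult: "coeff g (Poly_Mapping.single n (Poly_Mapping.single t 1) * p)
      = Poly_Mapping.single n 1 * coeff (- t + g) p" for g n t p
    by (rule poly_mapping_eqI)
      (simp add: lookup_coeff lookup_single_mult_nat lookup_single_mult_group)
  define F where "F = {g. \<exists>i\<in>{..card Y}. coeff g (\<phi> i) \<noteq> 0}"
  have F_eq: "F = (\<Union>i\<in>{..card Y}. \<Union>n\<in>Poly_Mapping.keys (\<phi> i). Poly_Mapping.keys (Poly_Mapping.lookup (\<phi> i) n))"
  proof -
    have coeff_nz: "coeff g p \<noteq> 0 \<longleftrightarrow> (\<exists>n\<in>Poly_Mapping.keys p. g \<in> Poly_Mapping.keys (Poly_Mapping.lookup p n))" for g p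
      unfolding poly_mapping_eq_iff fun_eq_iff lookup_coeff lookup_zero
      by (metis in_keys_iff lookup_zero)
    show ?thesis unfolding F_def coeff_nz by auto
  qed
  have "finite F" unfolding F_eq by simp
  moreover have "F \<noteq> {}"
  proof -
    obtain i n g where "i \<in> {..card Y}" "Poly_Mapping.lookup (Poly_Mapping.lookup (\<phi> i) n) g \<noteq> 0"
      using \<phi>(1) by (metis poly_mapping_eqI lookup_zero)
    then have "g \<in> F" unfolding F_def by (metis (mono_tags, lifting) lookup_coeff lookup_zero mem_Collect_eq)
    then show ?thesis by blast
  qed
  ultimately obtain f where f: "f \<in> F" and card: "card Y <
      card {(t, y). t \<in> T \<and> y \<in> X t \<and> (\<forall>t'\<in>T. y \<in> X t' \<and> - t' + (t + f) \<in> F \<longrightarrow> t' = t)}"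
    (is "_ < card ?W") using isolated unfolding isolated_pairs_def by blast
  have W: "?W \<subseteq> T \<times> Y" using XY by auto
  \<comment> \<open>Row \<open>y\<close> of the product at position \<open>t + f\<close>: isolation removes every other summand.\<close>
  have eq: "(\<Sum>i\<in>{..card Y}. Poly_Mapping.single (c (t, y) * i) 1 * coeff f (\<phi> i)) = 0"
    if ty: "(t, y) \<in> ?W" for t y
  proof -
    have y: "y \<in> Y" using ty XY by auto
    have "coeff (t + f) (\<Sum>i\<in>{..card Y}. A y i * \<phi> i) =
      (\<Sum>i\<in>{..card Y}. \<Sum>t' | t' \<in> T \<and> y \<in> X t'.
        Poly_Mapping.single (c (t', y) * i) 1 * coeff (- t' + (t + f)) (\<phi> i))"
      unfolding coeff_sum A_def sum_distrib_right coeff_mult ..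
    also have "\<dots> = (\<Sum>i\<in>{..card Y}. \<Sum>t'\<in>{t}.
        Poly_Mapping.single (c (t', y) * i) 1 * coeff (- t' + (t + f)) (\<phi> i))"
    proof (rule sum.cong[OF refl], rule sum.mono_neutral_right)
      fix i assume i: "i \<in> {..card Y}"
      show "\<forall>t'\<in>{t' \<in> T. y \<in> X t'} - {t}.
          Poly_Mapping.single (c (t', y) * i) 1 * coeff (- t' + (t + f)) (\<phi> i) = 0"
      proof
        fix t' assume t': "t' \<in> {t' \<in> T. y \<in> X t'} - {t}"
        then have "- t' + (t + f) \<notin> F" using ty by auto
        then have "coeff (- t' + (t + f)) (\<phi> i) = 0" using i unfolding F_def by blast
        then show "Poly_Mapping.single (c (t', y) * i) 1 * coeff (- t' + (t + f)) (\<phi> i) = 0"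
          by simp
      qed
    qed (use ty assms(1) in auto)
    also have "\<dots> = (\<Sum>i\<in>{..card Y}. Poly_Mapping.single (c (t, y) * i) 1 * coeff f (\<phi> i))"
      by simp
    finally show ?thesis using bspec[OF \<phi>(2) y] by (simp only: coeff_zero)
  qed
  let ?C = "(\<lambda>w. Poly_Mapping.single (c w) (1::'s)) ` ?W"
  have "inj_on (\<lambda>w. Poly_Mapping.single (c w) (1::'s)) ?W"
  proof (rule inj_onI)
    fix w w' assume ww: "w \<in> ?W" "w' \<in> ?W"
      and "Poly_Mapping.single (c w) (1::'s) = Poly_Mapping.single (c w') 1"
    then have "Poly_Mapping.keys (Poly_Mapping.single (c w) (1::'s))
        = Poly_Mapping.keys (Poly_Mapping.single (c w') (1::'s))" by simp
    then have "c w = c w'" by simp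
    then show "w = w'" using inj_onD[OF c] ww W by blast
  qed
  then have "card ?C = card ?W" by (rule card_image)
  have "finite ?W" using W assms(1,2) by (simp add: finite_subset)
  have "\<forall>i<Suc (card Y). coeff f (\<phi> i) = 0"
  proof (rule central_vandermonde)
    show "finite ?C" using \<open>finite ?W\<close> by simp
    show "Suc (card Y) \<le> card ?C" using card \<open>card ?C = card ?W\<close> by simp
  next
    fix x r assume "x \<in> ?C"
    then show "x * r = r * x" using central_monomial by blast
  next
    fix x assume "x \<in> ?C"
    then obtain t y where ty: "(t, y) \<in> ?W" and x: "x = Poly_Mapping.single (c (t, y)) 1"
      by blast
    show "(\<Sum>i<Suc (card Y). x ^ i * coeff f (\<phi> i)) = 0"
      using eq[OF ty] unfolding x monomial_power lessThan_Suc_atMost .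
  qed
  then show False using f unfolding F_def by auto
qed

text \<open>
  The sum of \<open>k\<close> copies of the expanding set \<open>T\<close> has at most \<open>2 ^ (card T * k)\<close> elements, so
  isolation costs a factor \<open>8 (card T * k + 2)\<close>; the expansion factor \<open>(1 + \<epsilon>) ^ k\<close> outgrows it.
\<close>

lemma uniform_expansion_imp_not_strong_rank_condition:
  fixes T :: "'g::group_add set" and \<epsilon> :: real
  assumes "finite T" "\<epsilon> > 0"
    and exp: "\<And>F. finite F \<Longrightarrow> F \<noteq> {} \<Longrightarrow> (1 + \<epsilon>) * card F \<le> real (card (T + F))"
  shows "\<not> strong_rank_condition TYPE(nat \<Rightarrow>\<^sub>0 ('s::ring_1_no_zero_divisors, 'g) group_ring)"
proof -
  obtain k :: nat where k: "8 * card T * k + 16 < (1 + \<epsilon>) ^ k"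
    using exponential_beats_linear[of "1 + \<epsilon>" "8 * card T" 16] \<open>\<epsilon> > 0\<close> by auto
  obtain T' :: "'g set" where "finite T' \<and> card T' \<le> card T ^ k \<and>
    (\<forall>F. finite F \<longrightarrow> F \<noteq> {} \<longrightarrow> (1 + \<epsilon>) ^ k * card F \<le> real (card (T' + F)))"
    using iterated_expansion[OF assms, of k] ..
  then have T': "finite T'" "card T' \<le> card T ^ k"
    "\<And>F. finite F \<Longrightarrow> F \<noteq> {} \<Longrightarrow> (1 + \<epsilon>) ^ k * card F \<le> real (card (T' + F))" by auto
  define L where "L = card T * k"
  have "card T' \<le> (2 ^ card T) ^ k"
    using T'(2) power_mono[of "card T" "2 ^ card T" k] by (simp add: less_imp_le le_trans)
  then have "card T' \<le> 2 ^ L" by (simp add: L_def power_mult)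
  then obtain Y :: "(nat \<times> ('g \<Rightarrow> nat)) set" and X where Y: "finite Y" "Y \<noteq> {}" "\<forall>t. X t \<subseteq> Y"
    "\<And>I. I \<subseteq> T' \<Longrightarrow> I \<noteq> {} \<Longrightarrow> card Y \<le> 8 * (L + 2) * card {y \<in> Y. \<exists>!t. t \<in> I \<and> y \<in> X t}"
    using isolating_family[OF T'(1), of L] by blast
  have "8 * (L + 2) * card F < card (T' + F)" if F: "finite F" "F \<noteq> {}" for F
  proof -
    have "real (8 * (L + 2)) * card F < (1 + \<epsilon>) ^ k * card F"
      using k F by (intro mult_strict_right_mono) (auto simp: L_def card_gt_0_iff)
    then have "real (8 * (L + 2)) * card F < card (T' + F)" using T'(3)[OF F] by linarith
    then show ?thesis unfolding of_nat_mult[symmetric] of_nat_less_iff .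
  qed
  then have iso: "\<exists>f\<in>F. card Y < card (isolated_pairs T' X F f)" if "finite F" "F \<noteq> {}" for F
    using that Y by (intro expansion_isolates[OF T'(1) Y(1,2)]) auto
  show ?thesis
    using T'(1) Y(1) Y(3)[rule_format] iso by (rule not_strong_rank_condition)
qed

section \<open>From the Foelner condition to an invariant mean\<close>

text \<open>
  For \<open>F'\<close> a translate of \<open>F\<close> and \<open>U\<close> only slightly larger, this bounds the defect of invariance of
  the normalised counting measure on \<open>F\<close>.
\<close>

lemma card_inter_almost_equal:
  assumes "finite U" "F \<subseteq> U" "F' \<subseteq> U" "card F = card F'"
  shows "\<bar>real (card (A \<inter> F')) - real (card (A \<inter> F))\<bar> \<le> real (card U) - real (card F)"
proof -
  have le: "card (A \<inter> E') + card E \<le> card (A \<inter> E) + card U" if E: "E \<subseteq> U" "E' \<subseteq> U" for E E'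
  proof -
    have "card (A \<inter> E') \<le> card ((A \<inter> E) \<union> (U - E))"
      using E assms(1) by (intro card_mono) (auto intro: finite_subset)
    also have "\<dots> \<le> card (A \<inter> E) + card (U - E)" by (rule card_Un_le)
    also have "card (U - E) = card U - card E"
      using E assms(1) by (simp add: card_Diff_subset finite_subset)
    finally show ?thesis using card_mono[OF assms(1) E(1)] by linarith
  qed
  show ?thesis using le[of F F'] le[of F' F] assms by linarith
qed

text \<open>
  The normalised counting measures of almost invariant finite sets are finitely additive and
  invariant up to a small error for finitely many group elements.  All these conditions are closed
  in the space of functions from subsets to \<open>[0, 1]\<close>, which is compact by Tychonoff's theorem, so
  some function satisfies all of them at once.
\<close>

lemma folner_imp_amenable:
  assumes folner: "\<And>(T :: 'g::group_add set) \<epsilon> :: real. finite T \<Longrightarrow> \<epsilon> > 0 \<Longrightarrow>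
    \<exists>F. finite F \<and> F \<noteq> {} \<and> real (card (T + F)) < (1 + \<epsilon>) * card F"
  shows "amenable TYPE('g)"
proof -
  define K :: "('g set \<Rightarrow> real) set" where "K = PiE UNIV (\<lambda>_. {0..1})"
  define P :: "('g set \<Rightarrow> real) set" where
    "P = {\<mu>. \<mu> UNIV = 1 \<and> (\<forall>A B. A \<inter> B = {} \<longrightarrow> \<mu> (A \<union> B) = \<mu> A + \<mu> B)}"
  define C :: "'g \<times> nat \<Rightarrow> ('g set \<Rightarrow> real) set" where
    "C = (\<lambda>(g, n). {\<mu>. \<forall>A. \<bar>\<mu> ((\<lambda>x. g + x) ` A) - \<mu> A\<bar> \<le> 1 / Suc n})"
  have "compactin (product_topology (\<lambda>_. euclidean) UNIV) K"
    unfolding K_def by (simp add: compactin_PiE)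
  then have "compact K"
    by (simp add: euclidean_product_topology)
  have ev: "continuous_on UNIV (\<lambda>\<mu> :: 'g set \<Rightarrow> real. \<mu> A)" for A
    by (rule continuous_on_product_coordinates)
  have "closed P"
    unfolding P_def
    by (intro closed_Collect_conj closed_Collect_all closed_Collect_imp closed_Collect_eq
        open_Collect_const continuous_intros ev)
  have "closed (C i)" for i
    unfolding C_def case_prod_unfold
    by (intro closed_Collect_all closed_Collect_le continuous_intros ev)
  have "(K \<inter> P) \<inter> (\<Inter>i\<in>UNIV. C i) \<noteq> {}"
  proof (rule compact_imp_fip_image)
    show "compact (K \<inter> P)" using \<open>compact K\<close> \<open>closed P\<close> by (rule compact_Int_closed)
    fix I :: "('g \<times> nat) set" assume "finite I"
    define T where "T = insert 0 ((\<lambda>i. - fst i) ` I)"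
    obtain N where N: "\<forall>n\<in>snd ` I. n \<le> N"
      using \<open>finite I\<close> finite_nat_set_iff_bounded_le by blast
    have "finite T" using \<open>finite I\<close> by (simp add: T_def)
    then obtain F where F: "finite F" "F \<noteq> {}" "real (card (T + F)) < (1 + 1 / Suc N) * card F"
      using folner[of T "1 / Suc N"] by auto
    have "card F > 0" using F by (simp add: card_gt_0_iff)
    define \<mu> where "\<mu> A = real (card (A \<inter> F)) / card F" for A
    have "\<mu> \<in> K" using F \<open>card F > 0\<close> by (auto simp: K_def \<mu>_def divide_le_eq_1 card_mono)
    moreover have "\<mu> \<in> P"
    proof -
      have "card ((A \<union> B) \<inter> F) = card (A \<inter> F) + card (B \<inter> F)" if "A \<inter> B = {}" for A B
        using that F(1) by (subst card_Un_disjoint[symmetric]) (auto simp: Int_Un_distrib2)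
      then show ?thesis using \<open>card F > 0\<close> by (auto simp: P_def \<mu>_def add_divide_distrib)
    qed
    moreover have "\<mu> \<in> C i" if "i \<in> I" for i
    proof -
      obtain g n where i: "i = (g, n)" by (cases i)
      define F' where "F' = (\<lambda>x. - g + x) ` F"
      have F'_iff: "x \<in> F' \<longleftrightarrow> g + x \<in> F" for x
      proof
        assume "g + x \<in> F"
        then have "- g + (g + x) \<in> F'" unfolding F'_def by (rule imageI)
        then show "x \<in> F'" by simp
      qed (auto simp: F'_def)
      have card_F': "card F = card F'" unfolding F'_def by (simp add: card_image inj_on_def)
      have "F \<subseteq> T + F" by (force simp: T_def set_plus_def)
      have "- g \<in> T" using that by (force simp: T_def i)
      then have "F' \<subseteq> T + F" unfolding F'_def by blast
      have close: "\<bar>real (card (A \<inter> F')) - real (card (A \<inter> F))\<bar> \<le> real (card (T + F)) - card F" for A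
        using \<open>F \<subseteq> T + F\<close> \<open>F' \<subseteq> T + F\<close> card_F' F(1) \<open>finite T\<close>
        by (intro card_inter_almost_equal finite_set_plus)
      have "n \<le> N" using N that by (force simp: i)
      have "real (card (T + F)) - card F \<le> 1 / Suc N * card F" using F(3) by (simp add: distrib_right)
      also have "\<dots> \<le> 1 / Suc n * card F"
        using \<open>n \<le> N\<close> by (intro mult_right_mono) (auto simp: frac_le)
      finally have small: "real (card (T + F)) - card F \<le> 1 / Suc n * card F" .
      have shift: "card ((\<lambda>x. g + x) ` A \<inter> F) = card (A \<inter> F')" for A
      proof -
        have "(\<lambda>x. g + x) ` A \<inter> F = (\<lambda>x. g + x) ` (A \<inter> F')"
          using F'_iff by auto
        then show ?thesis by (simp add: card_image inj_on_def)
      qed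
      have "\<bar>\<mu> ((\<lambda>x. g + x) ` A) - \<mu> A\<bar> \<le> 1 / Suc n" for A
      proof -
        have "\<bar>\<mu> ((\<lambda>x. g + x) ` A) - \<mu> A\<bar> = \<bar>real (card (A \<inter> F')) - real (card (A \<inter> F))\<bar> / card F"
          by (simp add: \<mu>_def shift diff_divide_distrib[symmetric])
        also have "\<dots> \<le> (1 / Suc n * card F) / card F"
          using order_trans[OF close small] by (rule divide_right_mono) simp
        also have "\<dots> = 1 / Suc n" using \<open>card F > 0\<close> by simp
        finally show ?thesis .
      qed
      then show ?thesis by (simp add: C_def i)
    qed
    ultimately show "(K \<inter> P) \<inter> (\<Inter>i\<in>I. C i) \<noteq> {}" by blast
  qed (use \<open>\<And>i. closed (C i)\<close> in blast)
  then obtain \<mu> where \<mu>: "\<mu> \<in> K" "\<mu> \<in> P" "\<And>g n. \<mu> \<in> C (g, n)" by blast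
  have "\<mu> ((\<lambda>x. g + x) ` A) = \<mu> A" for g A
  proof (rule ccontr)
    assume "\<mu> ((\<lambda>x. g + x) ` A) \<noteq> \<mu> A"
    then obtain n where "1 / Suc n < \<bar>\<mu> ((\<lambda>x. g + x) ` A) - \<mu> A\<bar>"
      using reals_Archimedean[of "\<bar>\<mu> ((\<lambda>x. g + x) ` A) - \<mu> A\<bar>"] by (auto simp: inverse_eq_divide)
    moreover have "\<bar>\<mu> ((\<lambda>x. g + x) ` A) - \<mu> A\<bar> \<le> 1 / Suc n"
      using \<mu>(3)[of g n] unfolding C_def by auto
    ultimately show False by linarith
  qed
  moreover have "0 \<le> \<mu> A" for A using \<mu>(1) unfolding K_def by (auto dest: PiE_mem[of _ _ _ A])
  ultimately show ?thesis using \<mu>(2) unfolding P_def amenable_def by (intro exI[of _ \<mu>]) auto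
qed

section \<open>Right Noetherian group rings\<close>

lemma right_noetherian_imp_amenable:
  assumes R: "right_noetherian TYPE(('s::ring_1_no_zero_divisors, 'g::group_add) group_ring)"
  shows "amenable TYPE('g)"
proof (rule folner_imp_amenable, rule ccontr)
  fix T :: "'g set" and \<epsilon> :: real
  assume T: "finite T" "\<epsilon> > 0"
    and "\<nexists>F. finite F \<and> F \<noteq> {} \<and> real (card (T + F)) < (1 + \<epsilon>) * card F"
  then have "(1 + \<epsilon>) * card F \<le> real (card (T + F))" if "finite F" "F \<noteq> {}" for F
    using that by (meson not_le)
  with T have "\<not> strong_rank_condition TYPE(nat \<Rightarrow>\<^sub>0 ('s, 'g) group_ring)"
    by (rule uniform_expansion_imp_not_strong_rank_condition)
  moreover have "strong_rank_condition TYPE(nat \<Rightarrow>\<^sub>0 ('s, 'g) group_ring)"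
    by (intro strong_rank_condition_polynomials right_noetherian_imp_strong_rank_condition R)
  ultimately show False by blast
qed

text \<open>
  Finitely many \<open>b \<in> H\<close> suffice to generate the right ideal of all \<open>h - 1\<close>.  For the subgroup \<open>K\<close>
  that they generate, the sum of the coefficients over \<open>K\<close> is a functional that kills
  \<open>(b - 1) r\<close> for every \<open>r\<close>, because left translation by \<open>b\<close> preserves \<open>K\<close>.  It does not kill \<open>h - 1\<close>
  when \<open>h \<notin> K\<close>.
\<close>

lemma right_noetherian_imp_fin_gen_subgroup:
  fixes H :: "'g::group_add set"
  assumes R: "right_noetherian TYPE(('s::ring_1, 'g) group_ring)" and H: "add_subgroup H"
  shows "fin_gen_subgroup H"
proof -
  define u :: "'g \<Rightarrow> ('s, 'g) group_ring" where
    "u h = Poly_Mapping.single h 1 + Poly_Mapping.single 0 (- 1)" for h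
  obtain F where F: "finite F" "F \<subseteq> u ` H" "u ` H \<subseteq> right_ideal hull F"
    using right_noetherian_finite_generation[OF R] by metis
  obtain B where B: "finite B" "B \<subseteq> H" "F = u ` B"
    using finite_subset_image[OF F(1,2)] by blast
  define K where "K = add_subgroup hull B"
  have "K \<subseteq> H" unfolding K_def using B(2) H by (rule hull_minimal)
  have sub: "add_subgroup K" unfolding K_def by (rule add_subgroup_hull)
  have coset: "b + g \<in> K \<longleftrightarrow> g \<in> K" if "b \<in> K" for b g
    using sub that unfolding add_subgroup_def by (metis minus_add_cancel)
  define \<sigma> :: "('s, 'g) group_ring \<Rightarrow> 's" where
    "\<sigma> x = (\<Sum>k\<in>Poly_Mapping.keys x. Poly_Mapping.lookup x k when k \<in> K)" for x
  have \<sigma>_add: "\<sigma> (x + y) = \<sigma> x + \<sigma> y" for x y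
    unfolding \<sigma>_def by (rule setsum_keys_plus_distrib) (auto simp: when_add_distrib)
  have \<sigma>_single: "\<sigma> (Poly_Mapping.single k a) = (a when k \<in> K)" for k a
    by (simp add: \<sigma>_def)
  have \<sigma>_0: "\<sigma> 0 = 0" by (simp add: \<sigma>_def)
  have \<sigma>_sum: "\<sigma> (sum f A) = (\<Sum>a\<in>A. \<sigma> (f a))" for f :: "'g \<Rightarrow> _" and A
    by (induction A rule: infinite_finite_induct) (auto simp: \<sigma>_0 \<sigma>_add)
  have ann: "\<sigma> (u b * r) = 0" if "b \<in> K" for b r
  proof (induction r rule: poly_mapping_monomial_induct)
    case (single k a)
    then show ?case
      using coset[OF that, of k] by (simp add: u_def distrib_right mult_single \<sigma>_add \<sigma>_single when_def)
  qed (auto simp: \<sigma>_0 distrib_left \<sigma>_add)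
  have "h \<in> K" if "h \<in> H" for h
  proof -
    have "u h \<in> right_ideal hull (u ` B)" using F(3) B(3) that by blast
    then obtain c where "u h = (\<Sum>b\<in>B. u b * c b)"
      using right_ideal_hull_image_combination[OF B(1)] by blast
    then have "\<sigma> (u h) = (\<Sum>b\<in>B. \<sigma> (u b * c b))" by (simp add: \<sigma>_sum)
    also have "\<dots> = 0" using ann hull_inc[of _ B add_subgroup] by (simp add: K_def)
    finally have "\<sigma> (u h) = 0" .
    moreover have "0 \<in> K" using sub by (simp add: add_subgroup_def)
    ultimately show "h \<in> K" by (auto simp: u_def \<sigma>_add \<sigma>_single when_def split: if_splits)
  qed
  then have "H = K" using \<open>K \<subseteq> H\<close> by blast
  then show ?thesis unfolding fin_gen_subgroup_def using H B(1) K_def by blast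
qed

section \<open>Left Noetherian group rings\<close>

typedef 'a opposite = "UNIV :: 'a set" morphisms unop op ..

setup_lifting type_definition_opposite

instantiation opposite :: (ring_1_no_zero_divisors) ring_1_no_zero_divisors
begin
lift_definition zero_opposite :: "'a opposite" is 0 .
lift_definition one_opposite :: "'a opposite" is 1 .
lift_definition plus_opposite :: "'a opposite \<Rightarrow> 'a opposite \<Rightarrow> 'a opposite" is "(+)" .
lift_definition minus_opposite :: "'a opposite \<Rightarrow> 'a opposite \<Rightarrow> 'a opposite" is "(-)" .
lift_definition uminus_opposite :: "'a opposite \<Rightarrow> 'a opposite" is uminus .
lift_definition times_opposite :: "'a opposite \<Rightarrow> 'a opposite \<Rightarrow> 'a opposite" is "\<lambda>a b. b * a" .
instance
  by standard (transfer, simp add: algebra_simps mult.assoc)+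
end

lemma left_noetherian_anti_hom:
  fixes \<theta> :: "'r::ring_1 \<Rightarrow> 'q::ring_1"
  assumes L: "left_noetherian TYPE('r)"
    and "surj \<theta>" and zero: "\<theta> 0 = 0" and add: "\<And>x y. \<theta> (x + y) = \<theta> x + \<theta> y"
    and mult: "\<And>x y. \<theta> (x * y) = \<theta> y * \<theta> x"
  shows "right_noetherian TYPE('q)"
  unfolding right_noetherian_def
proof (intro allI impI)
  fix I :: "'q set" assume I: "right_ideal I"
  have vimage: "left_ideal (\<theta> -` J)" if "right_ideal J" for J
    using that by (simp add: left_ideal_def right_ideal_def zero add mult)
  obtain A where A: "finite A" "\<theta> -` I = left_ideal hull A"
    using L vimage[OF I] unfolding left_noetherian_def by blast
  have "I = right_ideal hull (\<theta> ` A)"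
  proof
    show "right_ideal hull (\<theta> ` A) \<subseteq> I"
      using A(2) hull_subset[of A left_ideal] I by (intro hull_minimal) auto
    have "left_ideal hull A \<subseteq> \<theta> -` (right_ideal hull (\<theta> ` A))"
      using hull_subset[of "\<theta> ` A" right_ideal] by (intro hull_minimal vimage right_ideal_hull) auto
    then have "\<theta> ` (\<theta> -` I) \<subseteq> right_ideal hull (\<theta> ` A)"
      unfolding A(2)[symmetric] by blast
    then show "I \<subseteq> right_ideal hull (\<theta> ` A)"
      by (simp only: surj_image_vimage_eq[OF \<open>surj \<theta>\<close>])
  qed
  then show "\<exists>A. finite A \<and> I = right_ideal hull A" using A(1) by blast
qed

text \<open>
  Inversion of group elements together with the passage to the opposite coefficients is an
  anti-isomorphism of group rings.
\<close>

lemma left_noetherian_opposite: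
  assumes "left_noetherian TYPE(('s::ring_1_no_zero_divisors, 'g::group_add) group_ring)"
  shows "right_noetherian TYPE(('s opposite, 'g) group_ring)"
proof -
  define \<theta> :: "('s, 'g) group_ring \<Rightarrow> ('s opposite, 'g) group_ring" where
    "\<theta> x = Poly_Mapping.map op (Poly_Mapping.map_key uminus x)" for x
  have op0: "op 0 = (0 :: 's opposite)" by (simp add: zero_opposite_def)
  have op_add: "op (a + b) = op a + op b" for a b :: 's
    by (simp add: plus_opposite.abs_eq)
  have op_mult: "op (a * b) = op b * op a" for a b :: 's
    by (simp add: times_opposite.abs_eq)
  have look: "Poly_Mapping.lookup (\<theta> x) g = op (Poly_Mapping.lookup x (- g))" for x g
    unfolding \<theta>_def by (simp add: lookup_map op0 map_key.rep_eq)
  have \<theta>0: "\<theta> 0 = 0" by (rule poly_mapping_eqI) (simp add: look op0)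
  have add: "\<theta> (x + y) = \<theta> x + \<theta> y" for x y
    by (rule poly_mapping_eqI) (simp add: look lookup_add op_add)
  have \<theta>_single: "\<theta> (Poly_Mapping.single k a) = Poly_Mapping.single (- k) (op a)" for k a
    by (rule poly_mapping_eqI) (auto simp: look lookup_single when_def op0)
  have mult: "\<theta> (x * y) = \<theta> y * \<theta> x" for x y
  proof (induction x rule: poly_mapping_monomial_induct)
    case (single k a)
    show ?case
    proof (induction y rule: poly_mapping_monomial_induct)
      case (single l b)
      show ?case by (simp add: \<theta>_single mult_single op_mult minus_add)
    qed (auto simp: \<theta>0 add distrib_left distrib_right)
  qed (auto simp: \<theta>0 add distrib_left distrib_right)
  have "surj \<theta>"
  proof (rule surjI)
    fix y :: "('s opposite, 'g) group_ring"
    show "\<theta> (Poly_Mapping.map unop (Poly_Mapping.map_key uminus y)) = y"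
      by (rule poly_mapping_eqI)
        (simp add: look lookup_map map_key.rep_eq zero_opposite.rep_eq unop_inverse)
  qed
  then show ?thesis using left_noetherian_anti_hom[OF assms] \<theta>0 add mult by blast
qed

theorem corollaryB:
  assumes "right_noetherian TYPE(('s::ring_1_no_zero_divisors, 'g::group_add) group_ring) \<or>
           left_noetherian TYPE(('s, 'g) group_ring)"
  shows "amenable TYPE('g) \<and> (\<forall>H::'g set. add_subgroup H \<longrightarrow> fin_gen_subgroup H)"
proof -
  from assms consider "right_noetherian TYPE(('s, 'g) group_ring)"
    | "right_noetherian TYPE(('s opposite, 'g) group_ring)"
    using left_noetherian_opposite by blast
  then show ?thesis
    by cases (blast intro: right_noetherian_imp_amenable right_noetherian_imp_fin_gen_subgroup)+
qed

end
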